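(* Let $(a_k)_{k\ge1}$ be a sequence of scalars. Then the following are equivalent: (a) $\sup_{n}\frac1n\sum_{k=1}^n|a_k|<\infty$. (b) For every bounded linear operator $T$ on a (real or complex) Banach space $X$ and every $x\in X$ which is weakly stable for $T$, we have $\frac1n\sum_{k=1}^n a_kT^kx\to0$ weakly. (c) For every bounded linear operator $T$ on a (real or complex) Banach space $X$ and every $x\in X$ which is stable for $T$, we have $\frac1n\sum_{k=1}^n a_kT^kx\to0$ in norm.
   Context: A vector $x\in X$ is called stable for $T$ if $T^nx\to0$ in norm, and weakly stable for $T$ if $T^nx\to0$ weakly. In (b) and (c) the Banach space $X$ and the operator $T$ range over all Banach spaces and bounded operators for which the averages make sense, i.e. real Banach spaces are considered only when the sequence $(a_k)$ is real. *)

theory Defs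
  imports "HOL-Analysis.Analysis" "HOL-Algebra.Module"
begin

text \<open>
  The statement quantifies over all Banach spaces inside a formula, and for complex scalars there
  is no type class of normed spaces. Banach spaces are therefore carrier-based: modules in the sense
  of HOL-Algebra, over the field \<open>'k\<close> of scalars, whose vectors form a subset of a
  type \<open>'u\<close> (the universe), together with a norm. Only \<open>'k = real\<close> and \<open>'k = complex\<close> are used.

  The universe stays a type variable in the theorem, of cardinality at least that of the continuum.
  A smaller type carries no Banach space other than the zero space. Conversely, every
  Banach space, over any type, has an isometric copy in some such universe, so that letting the
  universe vary covers all Banach spaces.
\<close>

definition scalars :: "'k::real_normed_field ring" where
  "scalars = \<lparr>carrier = UNIV, mult = (*), one = 1, zero = 0, add = (+)\<rparr>"

record ('k, 'u) nspace = "('k, 'u) module" +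
  vnorm :: "'u \<Rightarrow> real"

text \<open>
  The fields \<open>mult\<close> and \<open>one\<close> that the record of a module inherits from rings are unused.
  Nonnegativity of the norm follows from the axioms below.
\<close>

definition normed_space :: "('k::real_normed_field, 'u) nspace \<Rightarrow> bool" where
  "normed_space X \<longleftrightarrow>
     Module.module scalars X \<and>
     (\<forall>x\<in>carrier X. vnorm X x = 0 \<longrightarrow> x = \<zero>\<^bsub>X\<^esub>) \<and>
     (\<forall>c. \<forall>x\<in>carrier X. vnorm X (c \<odot>\<^bsub>X\<^esub> x) = norm c * vnorm X x) \<and>
     (\<forall>x\<in>carrier X. \<forall>y\<in>carrier X. vnorm X (x \<oplus>\<^bsub>X\<^esub> y) \<le> vnorm X x + vnorm X y)"

text \<open>
  The \<open>if\<close> is needed because \<open>Metric_space\<close> requires the distance to be nonnegative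
  and symmetric on the whole type, also outside the carrier.
\<close>

definition ndist :: "('k::real_normed_field, 'u) nspace \<Rightarrow> 'u \<Rightarrow> 'u \<Rightarrow> real" where
  "ndist X x y =
     (if x \<in> carrier X \<and> y \<in> carrier X then vnorm X (x \<ominus>\<^bsub>X\<^esub> y) else 0)"

definition banach_space :: "('k::real_normed_field, 'u) nspace \<Rightarrow> bool" where
  "banach_space X \<longleftrightarrow> normed_space X \<and> Metric_space.mcomplete (carrier X) (ndist X)"

definition bounded_operator :: "('k::real_normed_field, 'u) nspace \<Rightarrow> ('u \<Rightarrow> 'u) \<Rightarrow> bool" where
  "bounded_operator X T \<longleftrightarrow>
     T \<in> carrier X \<rightarrow> carrier X \<and>
     (\<forall>x\<in>carrier X. \<forall>y\<in>carrier X. T (x \<oplus>\<^bsub>X\<^esub> y) = T x \<oplus>\<^bsub>X\<^esub> T y) \<and>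
     (\<forall>c. \<forall>x\<in>carrier X. T (c \<odot>\<^bsub>X\<^esub> x) = c \<odot>\<^bsub>X\<^esub> T x) \<and>
     (\<exists>C. \<forall>x\<in>carrier X. vnorm X (T x) \<le> C * vnorm X x)"

definition dual_space :: "('k::real_normed_field, 'u) nspace \<Rightarrow> ('u \<Rightarrow> 'k) set" where
  "dual_space X = {f.
     (\<forall>x\<in>carrier X. \<forall>y\<in>carrier X. f (x \<oplus>\<^bsub>X\<^esub> y) = f x + f y) \<and>
     (\<forall>c. \<forall>x\<in>carrier X. f (c \<odot>\<^bsub>X\<^esub> x) = c * f x) \<and>
     (\<exists>C. \<forall>x\<in>carrier X. norm (f x) \<le> C * vnorm X x)}"

definition norm_tendsto ::
  "('k::real_normed_field, 'u) nspace \<Rightarrow> (nat \<Rightarrow> 'u) \<Rightarrow> 'u \<Rightarrow> bool" where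
  "norm_tendsto X y l \<longleftrightarrow> (\<lambda>n. vnorm X (y n \<ominus>\<^bsub>X\<^esub> l)) \<longlonglongrightarrow> 0"

definition weak_tendsto ::
  "('k::real_normed_field, 'u) nspace \<Rightarrow> (nat \<Rightarrow> 'u) \<Rightarrow> 'u \<Rightarrow> bool" where
  "weak_tendsto X y l \<longleftrightarrow> (\<forall>f\<in>dual_space X. (\<lambda>n. f (y n)) \<longlonglongrightarrow> f l)"

definition stable :: "('k::real_normed_field, 'u) nspace \<Rightarrow> ('u \<Rightarrow> 'u) \<Rightarrow> 'u \<Rightarrow> bool" where
  "stable X T x \<longleftrightarrow> norm_tendsto X (\<lambda>n. (T ^^ n) x) \<zero>\<^bsub>X\<^esub>"

definition weakly_stable :: "('k::real_normed_field, 'u) nspace \<Rightarrow> ('u \<Rightarrow> 'u) \<Rightarrow> 'u \<Rightarrow> bool" where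
  "weakly_stable X T x \<longleftrightarrow> weak_tendsto X (\<lambda>n. (T ^^ n) x) \<zero>\<^bsub>X\<^esub>"

definition weighted_average ::
  "('k::real_normed_field, 'u) nspace \<Rightarrow> (nat \<Rightarrow> 'k) \<Rightarrow> ('u \<Rightarrow> 'u) \<Rightarrow> 'u \<Rightarrow> nat \<Rightarrow> 'u" where
  "weighted_average X a T x n =
     (1 / of_nat n) \<odot>\<^bsub>X\<^esub> (\<Oplus>\<^bsub>X\<^esub>k\<in>{1..n}. a k \<odot>\<^bsub>X\<^esub> (T ^^ k) x)"

text \<open>
  The two properties below range over Banach spaces over the scalar field \<open>'k\<close> of the
  sequence. For a complex sequence with real terms the theorem requires them both for the sequence
  itself (complex spaces) and for its real version (real spaces).
\<close>

definition weak_averages_null :: "'u itself \<Rightarrow> (nat \<Rightarrow> 'k::real_normed_field) \<Rightarrow> bool" where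
  "weak_averages_null _ a \<longleftrightarrow>
     (\<forall>(X :: ('k, 'u) nspace) T. banach_space X \<longrightarrow> bounded_operator X T \<longrightarrow>
        (\<forall>x\<in>carrier X. weakly_stable X T x \<longrightarrow>
           weak_tendsto X (weighted_average X a T x) \<zero>\<^bsub>X\<^esub>))"

definition norm_averages_null :: "'u itself \<Rightarrow> (nat \<Rightarrow> 'k::real_normed_field) \<Rightarrow> bool" where
  "norm_averages_null _ a \<longleftrightarrow>
     (\<forall>(X :: ('k, 'u) nspace) T. banach_space X \<longrightarrow> bounded_operator X T \<longrightarrow>
        (\<forall>x\<in>carrier X. stable X T x \<longrightarrow>
           norm_tendsto X (weighted_average X a T x) \<zero>\<^bsub>X\<^esub>))"

end

theory Submission
  imports Defs
begin

text \<open>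
  Testing against a functional (or taking norms) reduces the implication from (a) to (b) and (c)
  to the fact that bounded averages of \<open>\<bar>a\<^sub>k\<bar>\<close> turn null sequences \<open>b\<close> into sequences with
  \<open>(1/n) \<Sum> \<bar>a\<^sub>k\<bar> \<bar>b\<^sub>k\<bar> \<longlonglongrightarrow> 0\<close>. Conversely, the left shift \<open>T\<close> on \<open>c\<^sub>0\<close> makes every vector stable, and
  the zeroth coordinate of \<open>T\<^sup>k x\<close> is \<open>x\<^sub>k\<close>. If the averages \<open>s\<^sub>n\<close> of \<open>\<bar>a\<^sub>k\<bar>\<close> are unbounded, then the
  null sequence of modulus \<open>1 / max(1, s\<^sub>1, \<dots>, s\<^sub>n)\<close> with \<open>a\<^sub>k x\<^sub>k \<ge> 0\<close> has averages at
  least 1 whenever \<open>s\<^sub>n \<ge> 1\<close> is a record, so a single vector violates both (b) and (c).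
\<close>

section \<open>Weighted averages of scalar sequences\<close>

text \<open>Split the sum at an index \<open>N\<close> beyond which \<open>b\<close> stays below
  \<open>d\<close>. The head is bounded by a constant \<open>H\<close>, which the factor 1/n sends
  to 0; the tail is at most \<open>d\<close> times an average of the norms, hence at most
  \<open>d * M\<close>.\<close>

lemma weighted_averages_null:
  fixes a :: "nat \<Rightarrow> 'k::real_normed_field" and b :: "nat \<Rightarrow> real"
  assumes bdd: "bdd_above ((\<lambda>n. (1 / real n) * (\<Sum>k = 1..n. norm (a k))) ` {1..})"
    and b: "b \<longlonglongrightarrow> 0" and nonneg: "\<And>k. 0 \<le> b k"
  shows "(\<lambda>n. (1 / real n) * (\<Sum>k = 1..n. norm (a k) * b k)) \<longlonglongrightarrow> 0"
proof (rule LIMSEQ_I)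
  fix e :: real
  assume e: "0 < e"
  obtain M0 where M0: "\<And>n. n \<ge> 1 \<Longrightarrow> (1 / real n) * (\<Sum>k = 1..n. norm (a k)) \<le> M0"
    using bdd by (auto simp: bdd_above_def)
  \<comment> \<open>Adding 1 makes the bound strictly positive, so that
    \<open>d = e / (2 * M)\<close> is a positive number with \<open>d * M = e / 2\<close>.\<close>
  define M where "M = max M0 0 + 1"
  have M: "M > 0" and le_M: "n \<ge> 1 \<Longrightarrow> (1 / real n) * (\<Sum>k = 1..n. norm (a k)) \<le> M" for n
    using M0[of n] by (auto simp: M_def)
  define d where "d = e / (2 * M)"
  have d: "d > 0"
    using e M by (simp add: d_def)
  obtain N where N: "\<And>k. k \<ge> N \<Longrightarrow> b k < d"
    using LIMSEQ_D[OF b d] nonneg by auto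
  define H where "H = (\<Sum>k<N. norm (a k) * b k)"
  have "(\<lambda>n. H * (1 / real n)) \<longlonglongrightarrow> H * 0"
    by (intro tendsto_mult tendsto_const lim_1_over_n)
  then have "(\<lambda>n. H * (1 / real n)) \<longlonglongrightarrow> 0"
    by simp
  from order_tendstoD(2)[OF this, of "e/2"] obtain N' where
    N': "\<And>n. n \<ge> N' \<Longrightarrow> H * (1 / real n) < e / 2"
    using e by (auto simp: eventually_sequentially)
  have "norm ((1 / real n) * (\<Sum>k = 1..n. norm (a k) * b k) - 0) < e" if n: "n \<ge> max 1 N'" for n
  proof -
    have split: "norm (a k) * b k \<le> (if k < N then norm (a k) * b k else 0) + d * norm (a k)" for k
      using N[of k] d mult_left_mono[of "b k" d "norm (a k)"] by (auto simp: mult.commute)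
    have "(\<Sum>k = 1..n. norm (a k) * b k)
        \<le> (\<Sum>k = 1..n. (if k < N then norm (a k) * b k else 0) + d * norm (a k))"
      by (intro sum_mono split)
    also have "\<dots> = (\<Sum>k = 1..n. if k < N then norm (a k) * b k else 0)
        + d * (\<Sum>k = 1..n. norm (a k))"
      by (simp add: sum.distrib sum_distrib_left)
    also have "(\<Sum>k = 1..n. if k < N then norm (a k) * b k else 0)
        = (\<Sum>k\<in>{1..n} \<inter> {..<N}. norm (a k) * b k)"
      by (simp add: sum.inter_restrict)
    \<comment> \<open>The index set grows to all k < N, including 0, and the new terms are
      nonnegative. Thus \<open>H\<close> does not depend on \<open>n\<close>.\<close>
    also have "\<dots> \<le> H"
      unfolding H_def by (rule sum_mono2) (auto simp: nonneg)
    finally have "(1 / real n) * (\<Sum>k = 1..n. norm (a k) * b k)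
        \<le> (1 / real n) * (H + d * (\<Sum>k = 1..n. norm (a k)))"
      by (intro mult_left_mono) auto
    also have "\<dots> = H * (1 / real n) + d * ((1 / real n) * (\<Sum>k = 1..n. norm (a k)))"
      by (simp add: algebra_simps)
    also have "\<dots> < e / 2 + d * M"
      using N'[of n] n le_M[of n] d by (intro add_less_le_mono mult_left_mono) auto
    also have "\<dots> = e"
      using M by (simp add: d_def field_simps)
    finally have "(1 / real n) * (\<Sum>k = 1..n. norm (a k) * b k) < e" .
    moreover have "0 \<le> (1 / real n) * (\<Sum>k = 1..n. norm (a k) * b k)"
      by (intro mult_nonneg_nonneg sum_nonneg) (auto simp: nonneg)
    ultimately show ?thesis
      by simp
  qed
  then show "\<exists>no. \<forall>n\<ge>no. norm ((1 / real n) * (\<Sum>k = 1..n. norm (a k) * b k) - 0) < e"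
    by blast
qed

text \<open>Take the first index at which \<open>s\<close> exceeds a bound \<open>B\<close> that
  dominates \<open>C\<close> and all values up to \<open>N\<close>. All earlier values are at most
  \<open>B\<close>, so this index is a record, and by the choice of \<open>B\<close> it lies beyond
  \<open>N\<close>.\<close>

lemma frequently_record:
  fixes s :: "nat \<Rightarrow> real"
  assumes unbdd: "\<not> bdd_above (s ` {1..})"
  obtains n where "n \<ge> N" "n \<ge> 1" "s n \<ge> C" "\<And>j. 1 \<le> j \<Longrightarrow> j \<le> n \<Longrightarrow> s j \<le> s n"
proof -
  define B where "B = Max (insert C (s ` {1..N}))"
  have B: "C \<le> B" "\<And>j. 1 \<le> j \<Longrightarrow> j \<le> N \<Longrightarrow> s j \<le> B"
    unfolding B_def by (auto intro!: Max_ge simp del: Max_insert)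
  define P where "P n \<longleftrightarrow> n \<ge> 1 \<and> s n > B" for n
  have ex: "\<exists>n. P n"
    using unbdd by (force simp: bdd_above_def P_def not_le)
  define n where "n = (LEAST n. P n)"
  have n: "P n"
    unfolding n_def using ex by (rule LeastI_ex)
  have "s j \<le> s n" if "1 \<le> j" "j \<le> n" for j
  proof (cases "j = n")
    case False
    then have "\<not> P j"
      using that not_less_Least[of j P] by (simp add: n_def)
    then show ?thesis
      using that n by (auto simp: P_def)
  qed simp
  moreover have "n \<ge> N"
    using n B(2)[of n] by (force simp: P_def)
  ultimately show thesis
    using that[of n] n B(1) by (auto simp: P_def)
qed

text \<open>The factor \<open>cnj (sgn (a k))\<close> cancels the phase of \<open>a k\<close>, and
  dividing by the running maximum \<open>m k\<close> of the averages makes \<open>x\<close> null.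
  The decay is so slow that the weighted averages return to at least 1 at every record of height at
  least 1.\<close>

lemma unbounded_averages_witness:
  fixes a :: "nat \<Rightarrow> complex"
  assumes unbdd: "\<not> bdd_above ((\<lambda>n. (1 / real n) * (\<Sum>k = 1..n. norm (a k))) ` {1..})"
  obtains x :: "nat \<Rightarrow> complex"
  where "x \<longlonglongrightarrow> 0" "\<not> (\<lambda>n. (1 / of_nat n) * (\<Sum>k = 1..n. a k * x k)) \<longlonglongrightarrow> 0"
proof -
  define s where "s n = (1 / real n) * (\<Sum>k = 1..n. norm (a k))" for n
  have unbdd': "\<not> bdd_above (s ` {1..})"
    using unbdd by (simp add: s_def[abs_def])
  \<comment> \<open>Inserting 1 makes the maximum meaningful for n = 0 and keeps \<open>m\<close>
    positive, so that its inverse may be taken.\<close>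
  define m where "m n = Max (insert 1 (s ` {1..n}))" for n
  have m_ge_1: "m n \<ge> 1" for n
    by (simp add: m_def)
  have m_mono: "m k \<le> m n" if "k \<le> n" for k n
    unfolding m_def using that by (intro Max_mono) auto
  have s_le_m: "s n \<le> m n" if "n \<ge> 1" for n
    unfolding m_def using that by (intro Max_ge) auto
  have m_record: "m n = s n" if "s n \<ge> 1" "n \<ge> 1" "\<And>j. 1 \<le> j \<Longrightarrow> j \<le> n \<Longrightarrow> s j \<le> s n" for n
    unfolding m_def by (rule Max_eqI) (use that in auto)
  have m_lim: "filterlim m at_top sequentially"
    unfolding filterlim_at_top
  proof
    fix Z
    obtain n where "n \<ge> 1" "s n \<ge> Z"
      using frequently_record[OF unbdd', of 0 Z] by metis
    then have "Z \<le> m j" if "j \<ge> n" for j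
      using m_mono[OF that] s_le_m[of n] by linarith
    then show "eventually (\<lambda>n. Z \<le> m n) sequentially"
      by (auto simp: eventually_sequentially)
  qed
  define x where "x k = cnj (sgn (a k)) * of_real (inverse (m k))" for k
  have "(\<lambda>k. inverse (m k)) \<longlonglongrightarrow> 0"
    using m_lim by (rule tendsto_inverse_0_at_top)
  moreover have "norm (x k) \<le> inverse (m k)" for k
    using m_ge_1[of k] by (simp add: x_def norm_mult norm_sgn norm_inverse)
  ultimately have "x \<longlonglongrightarrow> 0"
    by (intro Lim_null_comparison[where f = x]) auto
  moreover have "\<not> (\<lambda>n. (1 / of_nat n) * (\<Sum>k = 1..n. a k * x k)) \<longlonglongrightarrow> 0"
  proof
    assume "(\<lambda>n. (1 / of_nat n) * (\<Sum>k = 1..n. a k * x k)) \<longlonglongrightarrow> 0"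
    from LIMSEQ_D[OF this, of 1] obtain N where
      N: "\<And>n. n \<ge> N \<Longrightarrow> norm ((1 / of_nat n) * (\<Sum>k = 1..n. a k * x k)) < 1"
      by auto
    obtain n where n: "n \<ge> N" "n \<ge> 1" "s n \<ge> 1" "\<And>j. 1 \<le> j \<Longrightarrow> j \<le> n \<Longrightarrow> s j \<le> s n"
      using frequently_record[OF unbdd', of N 1] by metis
    have ax: "a k * x k = of_real (norm (a k) * inverse (m k))" for k
    proof -
      \<comment> \<open>For nonzero a this is a * cnj a / |a| = |a|^2 / |a|; for a = 0 both sides
        vanish.\<close>
      have "a k * cnj (sgn (a k)) = of_real (norm (a k))"
        using complex_norm_square[of "a k"]
        by (cases "a k = 0") (simp_all add: sgn_eq power2_eq_square field_simps)
      then show ?thesis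
        by (simp add: x_def flip: mult.assoc)
    qed
    \<comment> \<open>At a record \<open>m n\<close> equals \<open>s n\<close>. Replacing
      \<open>m n\<close> by the smaller \<open>m k\<close> inside the sum can only increase it, so
      the average at \<open>n\<close> has norm at least 1.\<close>
    have "1 = s n * inverse (m n)"
      using m_record[of n] n by simp
    also have "\<dots> = (1 / real n) * (\<Sum>k = 1..n. norm (a k) * inverse (m n))"
      by (simp add: s_def sum_distrib_right)
    also have "\<dots> \<le> (1 / real n) * (\<Sum>k = 1..n. norm (a k) * inverse (m k))"
      by (intro mult_left_mono sum_mono le_imp_inverse_le m_mono order.strict_trans2[OF _ m_ge_1]) auto
    also have "\<dots> \<le> norm (of_real ((1 / real n) * (\<Sum>k = 1..n. norm (a k) * inverse (m k))) :: complex)"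
      by (simp only: norm_of_real abs_ge_self)
    also have "of_real ((1 / real n) * (\<Sum>k = 1..n. norm (a k) * inverse (m k)))
        = (1 / of_nat n) * (\<Sum>k = 1..n. a k * x k)"
      by (simp add: ax)
    also have "norm \<dots> < 1"
      using N n by blast
    finally show False
      by simp
  qed
  ultimately show thesis
    by (rule that)
qed

section \<open>Normed spaces with carrier\<close>

lemma cring_scalars: "cring (scalars :: 'k::real_normed_field ring)"
proof (rule cringI)
  show "abelian_group (scalars :: 'k ring)"
    by (rule abelian_groupI) (auto simp: scalars_def intro: exI[of _ "- _"] left_minus)
  show "comm_monoid (scalars :: 'k ring)"
    by (rule comm_monoidI) (auto simp: scalars_def)
qed (auto simp: scalars_def algebra_simps)

lemma abelian_group_minus_zero:
  assumes "abelian_group G" "x \<in> carrier G"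
  shows "x \<ominus>\<^bsub>G\<^esub> \<zero>\<^bsub>G\<^esub> = x"
proof -
  interpret abelian_group G by fact
  have "\<ominus>\<^bsub>G\<^esub> \<zero>\<^bsub>G\<^esub> = \<zero>\<^bsub>G\<^esub>"
    by (rule minus_equality) auto
  then show ?thesis
    using assms(2) by (simp add: a_minus_def)
qed

text \<open>Turns the predicate into a locale, so that the module laws over \<open>scalars\<close>
  are inherited and c_0 can later be treated by interpretation.\<close>

locale nspace_module =
  fixes X :: "('k::real_normed_field, 'u) nspace" (structure)
  assumes normed: "normed_space X"

sublocale nspace_module \<subseteq> Module.module "scalars :: 'k ring" X
  using normed by (simp add: normed_space_def)

context nspace_module
begin

lemma vsmult_closed [simp, intro]: "x \<in> carrier X \<Longrightarrow> c \<odot> x \<in> carrier X"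
  using smult_closed[of c x] by (simp add: scalars_def)

lemma vnorm_smult: "x \<in> carrier X \<Longrightarrow> vnorm X (c \<odot> x) = norm c * vnorm X x"
  using normed by (simp add: normed_space_def)

lemma vnorm_triangle:
  "x \<in> carrier X \<Longrightarrow> y \<in> carrier X \<Longrightarrow> vnorm X (x \<oplus> y) \<le> vnorm X x + vnorm X y"
  using normed by (simp add: normed_space_def)

lemma zero_smult: "x \<in> carrier X \<Longrightarrow> 0 \<odot> x = \<zero>\<^bsub>X\<^esub>"
  using smult_l_null[of x] by (simp add: scalars_def)

lemma vnorm_zero [simp]: "vnorm X \<zero>\<^bsub>X\<^esub> = 0"
  using vnorm_smult[of "\<zero>\<^bsub>X\<^esub>" 0] zero_smult[of "\<zero>\<^bsub>X\<^esub>"] by simp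

text \<open>Additive inverses are unique, and (-1)x + x = (-1 + 1)x = 0. This ties the group inverse
  to the scalar action, so that homogeneity determines the norm of an inverse.\<close>

lemma uminus_smult: "x \<in> carrier X \<Longrightarrow> \<ominus>\<^bsub>X\<^esub> x = (- 1) \<odot> x"
proof -
  assume x: "x \<in> carrier X"
  have "(- 1) \<odot> x \<oplus>\<^bsub>X\<^esub> 1 \<odot> x = (- 1 + 1) \<odot> x"
    using smult_l_distr[of "-1" 1 x] x by (simp add: scalars_def)
  moreover have "1 \<odot> x = x"
    using smult_one[of x] x by (simp add: scalars_def)
  ultimately show ?thesis
    using x by (intro M.minus_equality) (auto simp: zero_smult)
qed

lemma vnorm_uminus: "x \<in> carrier X \<Longrightarrow> vnorm X (\<ominus>\<^bsub>X\<^esub> x) = vnorm X x"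
  by (simp add: uminus_smult vnorm_smult)

text \<open>0 is the norm of x + (-x), which is at most twice the norm of x.\<close>

lemma vnorm_nonneg: "x \<in> carrier X \<Longrightarrow> 0 \<le> vnorm X x"
  using vnorm_triangle[of x "\<ominus>\<^bsub>X\<^esub> x"] by (simp add: vnorm_uminus M.r_neg)

lemma Metric_space_ndist: "Metric_space (carrier X) (ndist X)"
proof
  fix x y
  show "0 \<le> ndist X x y"
    by (simp add: ndist_def vnorm_nonneg)
  have "\<ominus>\<^bsub>X\<^esub> (x \<ominus>\<^bsub>X\<^esub> y) = y \<ominus>\<^bsub>X\<^esub> x" if "x \<in> carrier X" "y \<in> carrier X"
    using that by (simp add: a_minus_def M.minus_add M.a_comm)
  then show "ndist X x y = ndist X y x"
    using vnorm_uminus[of "x \<ominus>\<^bsub>X\<^esub> y"] by (auto simp: ndist_def)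
next
  fix x y
  assume xy: "x \<in> carrier X" "y \<in> carrier X"
  have "x = y" if "x \<ominus>\<^bsub>X\<^esub> y = \<zero>\<^bsub>X\<^esub>"
    using that xy M.minus_equality[of x "\<ominus>\<^bsub>X\<^esub> y"] by (simp add: a_minus_def)
  moreover have "x \<ominus>\<^bsub>X\<^esub> y = \<zero>\<^bsub>X\<^esub>" if "vnorm X (x \<ominus>\<^bsub>X\<^esub> y) = 0"
    using that xy normed by (simp add: normed_space_def)
  moreover have "x \<ominus>\<^bsub>X\<^esub> x = \<zero>\<^bsub>X\<^esub>"
    using xy by (simp add: a_minus_def M.r_neg)
  ultimately show "ndist X x y = 0 \<longleftrightarrow> x = y"
    using xy unfolding ndist_def by (metis vnorm_zero)
next
  fix x y z
  assume xyz: "x \<in> carrier X" "y \<in> carrier X" "z \<in> carrier X"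
  have "x \<ominus>\<^bsub>X\<^esub> z = (x \<ominus>\<^bsub>X\<^esub> y) \<oplus>\<^bsub>X\<^esub> (y \<ominus>\<^bsub>X\<^esub> z)"
  proof -
    have "(x \<oplus>\<^bsub>X\<^esub> \<ominus>\<^bsub>X\<^esub> y) \<oplus>\<^bsub>X\<^esub> (y \<oplus>\<^bsub>X\<^esub> \<ominus>\<^bsub>X\<^esub> z)
        = x \<oplus>\<^bsub>X\<^esub> ((\<ominus>\<^bsub>X\<^esub> y \<oplus>\<^bsub>X\<^esub> y) \<oplus>\<^bsub>X\<^esub> \<ominus>\<^bsub>X\<^esub> z)"
      using xyz by (simp only: M.a_assoc M.a_inv_closed M.a_closed)
    then show ?thesis
      using xyz by (simp add: a_minus_def M.l_neg)
  qed
  then show "ndist X x z \<le> ndist X x y + ndist X y z"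
    using xyz vnorm_triangle[of "x \<ominus>\<^bsub>X\<^esub> y" "y \<ominus>\<^bsub>X\<^esub> z"] by (simp add: ndist_def)
qed

section \<open>Convergence to zero, in norm and weakly\<close>

lemma norm_tendsto_zero_iff:
  assumes "\<And>n. y n \<in> carrier X"
  shows "norm_tendsto X y \<zero>\<^bsub>X\<^esub> \<longleftrightarrow> (\<lambda>n. vnorm X (y n)) \<longlonglongrightarrow> 0"
  using assms by (simp add: norm_tendsto_def abelian_group_minus_zero[OF M.abelian_group_axioms])

lemma dual_zero: "f \<in> dual_space X \<Longrightarrow> f \<zero>\<^bsub>X\<^esub> = 0"
  using zero_smult[of "\<zero>\<^bsub>X\<^esub>"] by (force simp: dual_space_def)

lemma weak_tendsto_zero_iff:
  "weak_tendsto X y \<zero>\<^bsub>X\<^esub> \<longleftrightarrow> (\<forall>f\<in>dual_space X. (\<lambda>n. f (y n)) \<longlonglongrightarrow> 0)"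
  by (simp add: weak_tendsto_def dual_zero)

text \<open>Every functional in the dual is dominated by a multiple of the norm. The lemma serves
  twice: stable vectors are weakly stable, and a failure of weak convergence refutes norm
  convergence.\<close>

lemma norm_tendsto_imp_weak_tendsto_zero:
  assumes y: "\<And>n. y n \<in> carrier X" and lim: "norm_tendsto X y \<zero>\<^bsub>X\<^esub>"
  shows "weak_tendsto X y \<zero>\<^bsub>X\<^esub>"
  unfolding weak_tendsto_zero_iff
proof
  fix f
  assume "f \<in> dual_space X"
  then obtain C where C: "\<And>x. x \<in> carrier X \<Longrightarrow> norm (f x) \<le> C * vnorm X x"
    unfolding dual_space_def by blast
  have "(\<lambda>n. C * vnorm X (y n)) \<longlonglongrightarrow> 0"
    using lim y by (intro tendsto_mult_right_zero) (simp add: norm_tendsto_zero_iff)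
  then show "(\<lambda>n. f (y n)) \<longlonglongrightarrow> 0"
    by (rule Lim_null_comparison[rotated]) (use C y in auto)
qed

lemma dual_finsum:
  assumes "f \<in> dual_space X" "finite A" "\<And>k. k \<in> A \<Longrightarrow> y k \<in> carrier X"
  shows "f (\<Oplus>\<^bsub>X\<^esub>k\<in>A. y k) = (\<Sum>k\<in>A. f (y k))"
  using assms(2,3)
proof (induction A rule: finite_induct)
  case empty
  then show ?case
    by (simp add: dual_zero[OF assms(1)])
next
  case (insert k A)
  then have "f (\<Oplus>\<^bsub>X\<^esub>k\<in>insert k A. y k) = f (y k \<oplus>\<^bsub>X\<^esub> (\<Oplus>\<^bsub>X\<^esub>k\<in>A. y k))"
    by (subst M.finsum_insert) auto
  also have "\<dots> = f (y k) + f (\<Oplus>\<^bsub>X\<^esub>k\<in>A. y k)"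
    using assms(1) insert.prems M.finsum_closed[of y A] by (auto simp: dual_space_def)
  finally show ?case
    using insert by simp
qed

lemma vnorm_finsum:
  assumes "finite A" "\<And>k. k \<in> A \<Longrightarrow> y k \<in> carrier X"
  shows "vnorm X (\<Oplus>\<^bsub>X\<^esub>k\<in>A. y k) \<le> (\<Sum>k\<in>A. vnorm X (y k))"
  using assms
proof (induction A rule: finite_induct)
  case (insert k A)
  then have "vnorm X (\<Oplus>\<^bsub>X\<^esub>k\<in>insert k A. y k) = vnorm X (y k \<oplus>\<^bsub>X\<^esub> (\<Oplus>\<^bsub>X\<^esub>k\<in>A. y k))"
    by (subst M.finsum_insert) auto
  also have "\<dots> \<le> vnorm X (y k) + vnorm X (\<Oplus>\<^bsub>X\<^esub>k\<in>A. y k)"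
    using insert.prems M.finsum_closed[of y A] by (auto intro!: vnorm_triangle)
  finally show ?case
    using insert by fastforce
qed simp

section \<open>Orbits and weighted averages of a bounded operator\<close>

context
  fixes T x
  assumes T: "bounded_operator X T" and x: "x \<in> carrier X"
begin

lemma orbit_closed: "(T ^^ n) x \<in> carrier X"
  by (induction n) (use T x in \<open>auto simp: bounded_operator_def\<close>)

lemma weighted_average_closed: "weighted_average X a T x n \<in> carrier X"
  unfolding weighted_average_def by (intro vsmult_closed M.finsum_closed) (auto simp: orbit_closed)

text \<open>Reduces weak convergence of the averages to a statement about scalar sequences, both for
  arbitrary functionals and for the coordinate functional on c_0.\<close>

lemma dual_weighted_average:
  assumes f: "f \<in> dual_space X"
  shows "f (weighted_average X a T x n) = (1 / of_nat n) * (\<Sum>k = 1..n. a k * f ((T ^^ k) x))"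
proof -
  have scale: "f (c \<odot> v) = c * f v" if "v \<in> carrier X" for c v
    using f that by (simp add: dual_space_def)
  have "f (weighted_average X a T x n) = (1 / of_nat n) * f (\<Oplus>\<^bsub>X\<^esub>k\<in>{1..n}. a k \<odot> (T ^^ k) x)"
    unfolding weighted_average_def by (intro scale M.finsum_closed) (auto simp: orbit_closed)
  also have "f (\<Oplus>\<^bsub>X\<^esub>k\<in>{1..n}. a k \<odot> (T ^^ k) x) = (\<Sum>k = 1..n. f (a k \<odot> (T ^^ k) x))"
    by (rule dual_finsum[OF f]) (auto simp: orbit_closed)
  also have "\<dots> = (\<Sum>k = 1..n. a k * f ((T ^^ k) x))"
    by (simp add: scale orbit_closed)
  finally show ?thesis .
qed

lemma vnorm_weighted_average:
  "vnorm X (weighted_average X a T x n)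
    \<le> (1 / real n) * (\<Sum>k = 1..n. norm (a k) * vnorm X ((T ^^ k) x))"
proof -
  have "vnorm X (weighted_average X a T x n)
      = norm (1 / of_nat n :: 'k) * vnorm X (\<Oplus>\<^bsub>X\<^esub>k\<in>{1..n}. a k \<odot> (T ^^ k) x)"
    unfolding weighted_average_def by (intro vnorm_smult M.finsum_closed) (auto simp: orbit_closed)
  also have "\<dots> \<le> norm (1 / of_nat n :: 'k) * (\<Sum>k = 1..n. vnorm X (a k \<odot> (T ^^ k) x))"
    by (intro mult_left_mono vnorm_finsum) (auto simp: orbit_closed)
  finally show ?thesis
    by (simp add: vnorm_smult orbit_closed norm_divide)
qed

end

end

section \<open>Bounded averages make the operator averages null\<close>

lemma bounded_averages_imp_weak_averages_null:
  assumes bdd: "bdd_above ((\<lambda>n. (1 / real n) * (\<Sum>k = 1..n. norm (a k))) ` {1..})"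
  shows "weak_averages_null TYPE('u) a"
  unfolding weak_averages_null_def
proof (intro allI impI ballI)
  fix X :: "('a, 'u) nspace" and T x
  assume X: "banach_space X" and T: "bounded_operator X T" and x: "x \<in> carrier X"
    and stable: "weakly_stable X T x"
  interpret nspace_module X
    using X by unfold_locales (simp add: banach_space_def)
  show "weak_tendsto X (weighted_average X a T x) \<zero>\<^bsub>X\<^esub>"
    unfolding weak_tendsto_zero_iff
  proof
    fix f
    assume f: "f \<in> dual_space X"
    have "(\<lambda>n. norm (f ((T ^^ n) x))) \<longlonglongrightarrow> 0"
      using stable f by (simp add: weakly_stable_def weak_tendsto_zero_iff tendsto_norm_zero)
    \<comment> \<open>The scalar lemma is applied to the moduli of a functional along the orbit, a
      null sequence by weak stability.\<close>
    then have "(\<lambda>n. (1 / real n) * (\<Sum>k = 1..n. norm (a k) * norm (f ((T ^^ k) x)))) \<longlonglongrightarrow> 0"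
      by (intro weighted_averages_null[OF bdd]) auto
    moreover have "norm (f (weighted_average X a T x n))
        \<le> (1 / real n) * (\<Sum>k = 1..n. norm (a k) * norm (f ((T ^^ k) x)))" for n
    proof -
      have "norm (f (weighted_average X a T x n))
          = (1 / real n) * norm (\<Sum>k = 1..n. a k * f ((T ^^ k) x))"
        by (simp add: dual_weighted_average[OF T x f] norm_mult norm_divide)
      also have "\<dots> \<le> (1 / real n) * (\<Sum>k = 1..n. norm (a k * f ((T ^^ k) x)))"
        by (intro mult_left_mono norm_sum) auto
      finally show ?thesis
        by (simp add: norm_mult)
    qed
    ultimately show "(\<lambda>n. f (weighted_average X a T x n)) \<longlonglongrightarrow> 0"
      by (intro Lim_null_comparison[where f = "\<lambda>n. f (weighted_average X a T x n)"]) auto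
  qed
qed

lemma bounded_averages_imp_norm_averages_null:
  assumes bdd: "bdd_above ((\<lambda>n. (1 / real n) * (\<Sum>k = 1..n. norm (a k))) ` {1..})"
  shows "norm_averages_null TYPE('u) a"
  unfolding norm_averages_null_def
proof (intro allI impI ballI)
  fix X :: "('a, 'u) nspace" and T x
  assume X: "banach_space X" and T: "bounded_operator X T" and x: "x \<in> carrier X"
    and stable: "stable X T x"
  interpret nspace_module X
    using X by unfold_locales (simp add: banach_space_def)
  have "(\<lambda>n. vnorm X ((T ^^ n) x)) \<longlonglongrightarrow> 0"
    using stable by (simp add: stable_def norm_tendsto_zero_iff orbit_closed[OF T x])
  \<comment> \<open>Here the null sequence is the norm along the orbit.\<close>
  then have "(\<lambda>n. (1 / real n) * (\<Sum>k = 1..n. norm (a k) * vnorm X ((T ^^ k) x))) \<longlonglongrightarrow> 0"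
    by (intro weighted_averages_null[OF bdd]) (auto simp: vnorm_nonneg orbit_closed[OF T x])
  then have "(\<lambda>n. vnorm X (weighted_average X a T x n)) \<longlonglongrightarrow> 0"
    by (rule Lim_null_comparison[rotated], intro always_eventually allI)
      (use vnorm_weighted_average[OF T x] in
        \<open>simp add: vnorm_nonneg weighted_average_closed[OF T x]\<close>)
  then show "norm_tendsto X (weighted_average X a T x) \<zero>\<^bsub>X\<^esub>"
    by (simp add: norm_tendsto_zero_iff weighted_average_closed[OF T x])
qed

section \<open>The space of null sequences\<close>

definition null_seqs :: "(nat \<Rightarrow> 'k::real_normed_field) set" where
  "null_seqs = {x. x \<longlonglongrightarrow> 0}"

definition sup_norm :: "(nat \<Rightarrow> 'k::real_normed_field) \<Rightarrow> real" where
  "sup_norm x = (SUP n. norm (x n))"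

text \<open>The supremum of reals is an upper bound only for a set bounded above; null sequences are
  bounded because they converge.\<close>

lemma norm_le_sup_norm: "x \<in> null_seqs \<Longrightarrow> norm (x n) \<le> sup_norm x"
  unfolding sup_norm_def
proof (rule cSUP_upper)
  assume "x \<in> null_seqs"
  then have "Bseq x"
    by (auto simp: null_seqs_def intro: convergent_imp_Bseq convergentI)
  then show "bdd_above (range (\<lambda>n. norm (x n)))"
    by (auto simp: Bseq_def bdd_above_def)
qed simp

lemma sup_norm_nonneg: "x \<in> null_seqs \<Longrightarrow> 0 \<le> sup_norm x"
  using norm_le_sup_norm[of x 0] norm_ge_zero[of "x 0"] by linarith

lemma sup_norm_le: "(\<And>n. norm (x n) \<le> B) \<Longrightarrow> sup_norm x \<le> B"
  unfolding sup_norm_def by (rule cSUP_least) auto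

lemma sup_norm_triangle:
  assumes "x \<in> null_seqs" "y \<in> null_seqs"
  shows "sup_norm (\<lambda>n. x n + y n) \<le> sup_norm x + sup_norm y"
  by (intro sup_norm_le norm_triangle_mono norm_le_sup_norm assms)

lemma null_seqs_scale: "x \<in> null_seqs \<Longrightarrow> (\<lambda>n. c * x n) \<in> null_seqs"
  by (auto simp: null_seqs_def intro: tendsto_mult_right_zero)

lemma null_seqs_add: "x \<in> null_seqs \<Longrightarrow> y \<in> null_seqs \<Longrightarrow> (\<lambda>n. x n + y n) \<in> null_seqs"
  by (auto simp: null_seqs_def intro: tendsto_add_zero)

lemma null_seqs_uminus: "x \<in> null_seqs \<Longrightarrow> (\<lambda>n. - x n) \<in> null_seqs"
  using null_seqs_scale[of x "-1"] by simp

lemma null_seqs_zero: "(\<lambda>n. 0) \<in> null_seqs"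
  by (simp add: null_seqs_def)

text \<open>The upper estimate holds for every scalar and every null sequence. Applied to
  \<open>inverse c\<close> and the scaled sequence, it yields the reverse estimate for nonzero
  \<open>c\<close>.\<close>

lemma sup_norm_scale:
  assumes x: "x \<in> null_seqs"
  shows "sup_norm (\<lambda>n. c * x n) = norm c * sup_norm x"
proof (rule antisym)
  have le: "sup_norm (\<lambda>n. c * y n) \<le> norm c * sup_norm y" if "y \<in> null_seqs" for c y
    using norm_le_sup_norm[OF that] by (intro sup_norm_le) (simp add: norm_mult mult_left_mono)
  then show "sup_norm (\<lambda>n. c * x n) \<le> norm c * sup_norm x"
    using x .
  show "norm c * sup_norm x \<le> sup_norm (\<lambda>n. c * x n)"
  proof (cases "c = 0")
    case False
    then have "sup_norm x \<le> norm (inverse c) * sup_norm (\<lambda>n. c * x n)"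
      using le[OF null_seqs_scale[OF x, of c], of "inverse c"] by (simp flip: mult.assoc)
    then show ?thesis
      using False by (simp add: norm_inverse norm_divide field_simps)
  qed (simp add: sup_norm_def)
qed

text \<open>The tail supremum is the norm of the k-fold left shift of \<open>x\<close>, so this is
  the stability of \<open>x\<close> under the shift.\<close>

lemma sup_norm_tail_null:
  assumes x: "x \<in> null_seqs"
  shows "(\<lambda>k. sup_norm (\<lambda>n. x (n + k))) \<longlonglongrightarrow> 0"
proof (rule LIMSEQ_I)
  fix e :: real
  assume "0 < e"
  then obtain N where N: "\<And>n. n \<ge> N \<Longrightarrow> norm (x n) < e / 2"
    using x LIMSEQ_D[of x 0 "e/2"] by (auto simp: null_seqs_def)
  have "norm (sup_norm (\<lambda>n. x (n + k)) - 0) < e" if "k \<ge> N" for k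
  proof -
    have "sup_norm (\<lambda>n. x (n + k)) \<le> e / 2"
      using that by (intro sup_norm_le less_imp_le[OF N]) simp
    moreover have "(\<lambda>n. x (n + k)) \<in> null_seqs"
      using x by (simp add: null_seqs_def LIMSEQ_ignore_initial_segment)
    then have "0 \<le> sup_norm (\<lambda>n. x (n + k))"
      by (rule sup_norm_nonneg)
    ultimately show ?thesis
      using \<open>0 < e\<close> by simp
  qed
  then show "\<exists>no. \<forall>k\<ge>no. norm (sup_norm (\<lambda>n. x (n + k)) - 0) < e"
    by blast
qed

text \<open>Completeness of c_0: Cauchy in the supremum norm means uniformly Cauchy, so completeness
  of the scalars gives a uniform limit, and uniform limits of null sequences are null.\<close>

lemma null_seqs_complete:
  fixes y :: "nat \<Rightarrow> nat \<Rightarrow> 'k::{real_normed_field, banach}"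
  assumes y: "\<And>k. y k \<in> null_seqs"
    and Cauchy: "\<And>e. e > 0 \<Longrightarrow> \<exists>N. \<forall>k\<ge>N. \<forall>l\<ge>N. sup_norm (\<lambda>n. y k n - y l n) < e"
  obtains z where "z \<in> null_seqs" "(\<lambda>k. sup_norm (\<lambda>n. y k n - z n)) \<longlonglongrightarrow> 0"
proof -
  have diff: "(\<lambda>n. y k n - y l n) \<in> null_seqs" for k l
    using null_seqs_add[OF y null_seqs_uminus[OF y], of k l] by simp
  have "uniformly_Cauchy_on UNIV y"
    unfolding uniformly_Cauchy_on_def dist_norm
    using Cauchy norm_le_sup_norm[OF diff] by (meson le_less_trans)
  then obtain z where z: "uniform_limit UNIV y z sequentially"
    using Cauchy_uniformly_convergent by (auto simp: uniformly_convergent_on_def)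
  have "z \<longlonglongrightarrow> 0"
  \<comment> \<open>Interchange of limits: every \<open>y k\<close> tends to 0, and
    \<open>y k\<close> tends to \<open>z\<close> uniformly, so \<open>z\<close> tends to the limit
    of the constant 0.\<close>
  proof (rule swap_uniform_limit'[OF _ tendsto_const z])
    show "\<forall>\<^sub>F k in sequentially. (y k \<longlongrightarrow> 0) sequentially"
      using y by (simp add: null_seqs_def)
  qed auto
  then have null: "z \<in> null_seqs"
    by (simp add: null_seqs_def)
  have "(\<lambda>k. sup_norm (\<lambda>n. y k n - z n)) \<longlonglongrightarrow> 0"
  proof (rule LIMSEQ_I)
    fix e :: real
    assume e: "0 < e"
    then obtain N where N: "\<And>k n. k \<ge> N \<Longrightarrow> norm (y k n - z n) < e / 2"
      using uniform_limitD[OF z, of "e/2"] by (auto simp: eventually_sequentially dist_norm)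
    have "norm (sup_norm (\<lambda>n. y k n - z n) - 0) < e" if "k \<ge> N" for k
    proof -
      have "sup_norm (\<lambda>n. y k n - z n) \<le> e / 2"
        using that by (intro sup_norm_le less_imp_le[OF N])
      moreover have "0 \<le> sup_norm (\<lambda>n. y k n - z n)"
        using sup_norm_nonneg[OF null_seqs_add[OF y null_seqs_uminus[OF null]], of k] by simp
      ultimately show ?thesis
        using e by simp
    qed
    then show "\<exists>no. \<forall>k\<ge>no. norm (sup_norm (\<lambda>n. y k n - z n) - 0) < e"
      by blast
  qed
  with null show thesis
    by (rule that)
qed

text \<open>
  The space \<open>c\<^sub>0\<close>, transported into the universe \<open>'u\<close> along an injection. The values of the fields
  \<open>mult\<close> and \<open>one\<close> are arbitrary.
\<close>

definition c0_space :: "((nat \<Rightarrow> 'k::real_normed_field) \<Rightarrow> 'u) \<Rightarrow> ('k, 'u) nspace" where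
  "c0_space \<iota> = \<lparr>carrier = \<iota> ` null_seqs, mult = (\<lambda>u v. u), one = \<iota> (\<lambda>n. 0), zero = \<iota> (\<lambda>n. 0),
     add = (\<lambda>u v. \<iota> (\<lambda>n. the_inv \<iota> u n + the_inv \<iota> v n)),
     smult = (\<lambda>c u. \<iota> (\<lambda>n. c * the_inv \<iota> u n)),
     vnorm = (\<lambda>u. sup_norm (the_inv \<iota> u))\<rparr>"

text \<open>The backward shift drops the entry at index 0, so that the entry at index 0 of its k-th
  iterate is the k-th entry of the original sequence.\<close>

definition left_shift :: "((nat \<Rightarrow> 'k) \<Rightarrow> 'u) \<Rightarrow> 'u \<Rightarrow> 'u" where
  "left_shift \<iota> u = \<iota> (\<lambda>n. the_inv \<iota> u (Suc n))"

context
  fixes \<iota> :: "(nat \<Rightarrow> 'k::{real_normed_field, banach}) \<Rightarrow> 'u"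
  assumes inj: "inj \<iota>"
begin

lemma c0_simps [simp]:
  "the_inv \<iota> (\<iota> x) = x"
  "carrier (c0_space \<iota>) = \<iota> ` null_seqs"
  "\<zero>\<^bsub>c0_space \<iota>\<^esub> = \<iota> (\<lambda>n. 0)"
  "u \<oplus>\<^bsub>c0_space \<iota>\<^esub> v = \<iota> (\<lambda>n. the_inv \<iota> u n + the_inv \<iota> v n)"
  "c \<odot>\<^bsub>c0_space \<iota>\<^esub> u = \<iota> (\<lambda>n. c * the_inv \<iota> u n)"
  "vnorm (c0_space \<iota>) u = sup_norm (the_inv \<iota> u)"
  by (simp_all add: c0_space_def the_inv_f_f[OF inj])

lemma abelian_group_c0: "abelian_group (c0_space \<iota>)"
proof (rule abelian_groupI)
  fix u
  assume "u \<in> carrier (c0_space \<iota>)"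
  then obtain x where x: "u = \<iota> x" "x \<in> null_seqs"
    by auto
  show "\<exists>v\<in>carrier (c0_space \<iota>). v \<oplus>\<^bsub>c0_space \<iota>\<^esub> u = \<zero>\<^bsub>c0_space \<iota>\<^esub>"
    using x null_seqs_uminus[OF x(2)] by (intro bexI[of _ "\<iota> (\<lambda>n. - x n)"]) auto
qed (auto simp: null_seqs_add null_seqs_zero add_ac)

lemma normed_space_c0: "normed_space (c0_space \<iota>)"
  unfolding normed_space_def
proof (intro conjI ballI allI impI)
  show "Module.module scalars (c0_space \<iota>)"
    by (rule moduleI[OF cring_scalars abelian_group_c0])
      (auto simp: scalars_def null_seqs_scale algebra_simps)
  fix u
  assume "u \<in> carrier (c0_space \<iota>)"
  then obtain x where x: "u = \<iota> x" "x \<in> null_seqs"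
    by auto
  show "u = \<zero>\<^bsub>c0_space \<iota>\<^esub>" if "vnorm (c0_space \<iota>) u = 0"
    using that x norm_le_sup_norm[OF x(2)] by (auto intro!: arg_cong[of _ _ \<iota>])
  show "vnorm (c0_space \<iota>) (c \<odot>\<^bsub>c0_space \<iota>\<^esub> u) = norm c * vnorm (c0_space \<iota>) u" for c
    using x by (simp add: sup_norm_scale)
qed (auto intro: sup_norm_triangle)

interpretation c0: nspace_module "c0_space \<iota>"
  by unfold_locales (rule normed_space_c0)

lemma ndist_c0:
  assumes "x \<in> null_seqs" "y \<in> null_seqs"
  shows "ndist (c0_space \<iota>) (\<iota> x) (\<iota> y) = sup_norm (\<lambda>n. x n - y n)"
  using assms by (simp add: ndist_def a_minus_def c0.uminus_smult)

text \<open>A Cauchy sequence in the carrier is pulled back along \<open>\<iota>\<close> to null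
  sequences, and the limit found there is pushed forward again.\<close>

lemma banach_space_c0: "banach_space (c0_space \<iota>)"
  unfolding banach_space_def
proof (intro conjI normed_space_c0)
  interpret Metric_space "carrier (c0_space \<iota>)" "ndist (c0_space \<iota>)"
    by (rule c0.Metric_space_ndist)
  show mcomplete
    unfolding mcomplete_def
  proof (intro allI impI)
    fix \<sigma>
    assume \<sigma>: "MCauchy \<sigma>"
    define y where "y k = the_inv \<iota> (\<sigma> k)" for k
    have "\<sigma> k \<in> \<iota> ` null_seqs" for k
      using \<sigma> unfolding MCauchy_def by (auto simp: image_subset_iff)
    then have y: "\<sigma> k = \<iota> (y k) \<and> y k \<in> null_seqs" for k
      unfolding y_def by (metis c0_simps(1) imageE)
    have Cauchy: "\<exists>N. \<forall>k\<ge>N. \<forall>l\<ge>N. sup_norm (\<lambda>n. y k n - y l n) < e" if "e > 0" for e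
      using \<sigma> that unfolding MCauchy_def by (simp add: y ndist_c0)
    obtain z where z: "z \<in> null_seqs" "(\<lambda>k. sup_norm (\<lambda>n. y k n - z n)) \<longlonglongrightarrow> 0"
      by (rule null_seqs_complete[OF conjunct2[OF y] Cauchy])
    have "limitin mtopology \<sigma> (\<iota> z) sequentially"
      unfolding limitin_metric_dist_null using z y by (simp add: ndist_c0)
    then show "\<exists>u. limitin mtopology \<sigma> u sequentially"
      by blast
  qed
qed

section \<open>The left shift on c_0 as a counterexample\<close>

lemma bounded_operator_left_shift: "bounded_operator (c0_space \<iota>) (left_shift \<iota>)"
  unfolding bounded_operator_def
\<comment> \<open>Dropping an entry cannot raise the supremum, so the shift has bound 1.\<close>
proof (intro conjI exI[of _ 1])
  have shift: "(\<lambda>n. x (Suc n)) \<in> null_seqs" if "x \<in> null_seqs" for x :: "nat \<Rightarrow> 'k"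
    using that by (simp add: null_seqs_def LIMSEQ_Suc)
  then show "left_shift \<iota> \<in> carrier (c0_space \<iota>) \<rightarrow> carrier (c0_space \<iota>)"
    by (auto simp: left_shift_def)
  show "\<forall>u\<in>carrier (c0_space \<iota>). vnorm (c0_space \<iota>) (left_shift \<iota> u) \<le> 1 * vnorm (c0_space \<iota>) u"
    by (auto simp: left_shift_def intro: sup_norm_le norm_le_sup_norm)
qed (auto simp: left_shift_def)

lemma left_shift_funpow: "(left_shift \<iota> ^^ k) (\<iota> x) = \<iota> (\<lambda>n. x (n + k))"
  by (induction k) (simp_all add: left_shift_def)

lemma stable_left_shift:
  assumes x: "x \<in> null_seqs"
  shows "stable (c0_space \<iota>) (left_shift \<iota>) (\<iota> x)"
proof -
  have "(left_shift \<iota> ^^ k) (\<iota> x) \<in> carrier (c0_space \<iota>)" for k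
    using x by (intro c0.orbit_closed bounded_operator_left_shift) simp
  then show ?thesis
    using sup_norm_tail_null[OF x]
    by (simp add: stable_def c0.norm_tendsto_zero_iff left_shift_funpow del: c0_simps(2,3))
qed

lemma coordinate_in_dual: "(\<lambda>u. the_inv \<iota> u 0) \<in> dual_space (c0_space \<iota>)"
  by (auto simp: dual_space_def intro!: exI[of _ 1] norm_le_sup_norm)

text \<open>The functional reading off the entry at index 0 sends the k-th iterate to
  \<open>x k\<close>, hence the operator averages to the scalar averages of
  \<open>a k * x k\<close>.\<close>

lemma weighted_average_left_shift_not_weakly_null:
  fixes a :: "nat \<Rightarrow> 'k"
  assumes x: "x \<in> null_seqs"
    and not_null: "\<not> (\<lambda>n. (1 / of_nat n) * (\<Sum>k = 1..n. a k * x k)) \<longlonglongrightarrow> 0"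
  shows "\<not> weak_tendsto (c0_space \<iota>)
    (weighted_average (c0_space \<iota>) a (left_shift \<iota>) (\<iota> x)) \<zero>\<^bsub>c0_space \<iota>\<^esub>"
proof -
  have "the_inv \<iota> (weighted_average (c0_space \<iota>) a (left_shift \<iota>) (\<iota> x) n) 0
      = (1 / of_nat n) * (\<Sum>k = 1..n. a k * x k)" for n
    using x c0.dual_weighted_average[OF bounded_operator_left_shift _ coordinate_in_dual, of "\<iota> x" a n]
    by (simp add: left_shift_funpow)
  then show ?thesis
    using not_null coordinate_in_dual unfolding c0.weak_tendsto_zero_iff by force
qed

lemma not_weak_averages_null:
  fixes a :: "nat \<Rightarrow> 'k"
  assumes x: "x \<in> null_seqs"
    and not_null: "\<not> (\<lambda>n. (1 / of_nat n) * (\<Sum>k = 1..n. a k * x k)) \<longlonglongrightarrow> 0"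
  shows "\<not> weak_averages_null TYPE('u) a"
proof
  assume *: "weak_averages_null TYPE('u) a"
  have "weakly_stable (c0_space \<iota>) (left_shift \<iota>) (\<iota> x)"
    unfolding weakly_stable_def
    by (intro c0.norm_tendsto_imp_weak_tendsto_zero stable_left_shift[OF x, unfolded stable_def]
        c0.orbit_closed bounded_operator_left_shift) (simp add: x)
  then have "weak_tendsto (c0_space \<iota>)
      (weighted_average (c0_space \<iota>) a (left_shift \<iota>) (\<iota> x)) \<zero>\<^bsub>c0_space \<iota>\<^esub>"
    using x by (intro *[unfolded weak_averages_null_def, rule_format] banach_space_c0
        bounded_operator_left_shift) auto
  then show False
    using weighted_average_left_shift_not_weakly_null[OF x not_null] by blast
qed

text \<open>Norm convergence would imply weak convergence, so the vector that refutes the weak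
  statement also refutes this one.\<close>

lemma not_norm_averages_null:
  fixes a :: "nat \<Rightarrow> 'k"
  assumes x: "x \<in> null_seqs"
    and not_null: "\<not> (\<lambda>n. (1 / of_nat n) * (\<Sum>k = 1..n. a k * x k)) \<longlonglongrightarrow> 0"
  shows "\<not> norm_averages_null TYPE('u) a"
proof
  assume *: "norm_averages_null TYPE('u) a"
  have "norm_tendsto (c0_space \<iota>)
      (weighted_average (c0_space \<iota>) a (left_shift \<iota>) (\<iota> x)) \<zero>\<^bsub>c0_space \<iota>\<^esub>"
    using x by (intro *[unfolded norm_averages_null_def, rule_format] banach_space_c0
        bounded_operator_left_shift stable_left_shift) auto
  then have "weak_tendsto (c0_space \<iota>)
      (weighted_average (c0_space \<iota>) a (left_shift \<iota>) (\<iota> x)) \<zero>\<^bsub>c0_space \<iota>\<^esub>"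
    by (intro c0.norm_tendsto_imp_weak_tendsto_zero c0.weighted_average_closed
        bounded_operator_left_shift) (simp add: x)
  then show False
    using weighted_average_left_shift_not_weakly_null[OF x not_null] by blast
qed

end

section \<open>Cardinality of the space of complex sequences, and the equivalence\<close>

lemma complex_seqs_lepoll_reals: "(UNIV :: (nat \<Rightarrow> complex) set) \<lesssim> (UNIV :: real set)"
proof -
  \<comment> \<open>A complex sequence is encoded by the rational lower cuts of its real parts
    (\<open>b\<close> true) and imaginary parts (\<open>b\<close> false). The triples are countable,
    so \<open>to_nat\<close> turns this into a set of naturals.\<close>
  define cut where "cut x = to_nat ` {(n, b, q :: rat). of_rat q < (if b then Re (x n) else Im (x n))}"
    for x :: "nat \<Rightarrow> complex"
  have "inj cut"
  proof
    fix x y :: "nat \<Rightarrow> complex"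
    assume "cut x = cut y"
    then have "{(n, b, q :: rat). of_rat q < (if b then Re (x n) else Im (x n))}
        = {(n, b, q). of_rat q < (if b then Re (y n) else Im (y n))}"
      unfolding cut_def by (simp add: inj_image_eq_iff)
    then have *: "of_rat q < (if b then Re (x n) else Im (x n))
        \<longleftrightarrow> of_rat q < (if b then Re (y n) else Im (y n))" for n b and q :: rat
      by (simp add: set_eq_iff)
    \<comment> \<open>Two distinct reals are separated by a rational, which then belongs to only one
      of the cuts.\<close>
    have eq: "r = s" if "\<And>q :: rat. of_rat q < r \<longleftrightarrow> of_rat q < s" for r s :: real
      using that of_rat_dense[of r s] of_rat_dense[of s r]
      by (metis linorder_neqE_linordered_idom order_less_asym)
    show "x = y"
      by (intro ext complex_eqI eq) (use *[of _ True] *[of _ False] in simp_all)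
  qed
  then have "(UNIV :: (nat \<Rightarrow> complex) set) \<lesssim> (UNIV :: nat set set)"
    by (auto simp: lepoll_def)
  then show ?thesis
    using nat_sets_eqpoll_reals eqpoll_imp_lepoll lepoll_trans by blast
qed

theorem proposition2p5:
  fixes a :: "nat \<Rightarrow> complex"
  assumes universe: "(UNIV :: real set) \<lesssim> (UNIV :: 'u set)"
  defines "real_seq \<equiv> (\<forall>k\<ge>1. a k \<in> \<real>)"
  defines "A \<equiv> bdd_above ((\<lambda>n. (1 / real n) * (\<Sum>k = 1..n. norm (a k))) ` {1..})"
  defines "B \<equiv> weak_averages_null TYPE('u) a \<and>
                (real_seq \<longrightarrow> weak_averages_null TYPE('u) (\<lambda>k. Re (a k)))"
  defines "C \<equiv> norm_averages_null TYPE('u) a \<and>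
                (real_seq \<longrightarrow> norm_averages_null TYPE('u) (\<lambda>k. Re (a k)))"
  shows "(A \<longleftrightarrow> B) \<and> (B \<longleftrightarrow> C)"
proof -
  have real: "bdd_above ((\<lambda>n. (1 / real n) * (\<Sum>k = 1..n. norm (Re (a k)))) ` {1..})"
    if A and real_seq
  proof -
    \<comment> \<open>The sums start at k = 1, exactly where \<open>real_seq\<close> makes
      \<open>a k\<close> real.\<close>
    have "norm (Re (a k)) = norm (a k)" if "k \<ge> 1" for k
      using \<open>real_seq\<close> that by (auto simp: real_seq_def norm_complex_def complex_is_Real_iff)
    then show ?thesis
      using \<open>A\<close> by (simp add: A_def)
  qed
  have "B \<and> C" if A
    unfolding B_def C_def
    using that[unfolded A_def] real[OF that]
    by (intro conjI impI bounded_averages_imp_weak_averages_null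
        bounded_averages_imp_norm_averages_null)
  \<comment> \<open>Both \<open>B\<close> and \<open>C\<close> contain the statement for complex
    spaces, so one vector of complex c_0, embedded in the universe, refutes both even when the
    sequence is real.\<close>
  moreover have "\<not> B \<and> \<not> C" if notA: "\<not> A"
  proof -
    obtain x where x: "x \<in> null_seqs" "\<not> (\<lambda>n. (1 / of_nat n) * (\<Sum>k = 1..n. a k * x k)) \<longlonglongrightarrow> 0"
      using unbounded_averages_witness[OF notA[unfolded A_def]] by (auto simp: null_seqs_def)
    obtain \<iota> :: "(nat \<Rightarrow> complex) \<Rightarrow> 'u" where \<iota>: "inj \<iota>"
      using lepoll_trans[OF complex_seqs_lepoll_reals universe] by (auto simp: lepoll_def)
    then show ?thesis
      using not_weak_averages_null[OF \<iota> x] not_norm_averages_null[OF \<iota> x] by (simp add: B_def C_def)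
  qed
  ultimately show ?thesis
    by blast
qed

end
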